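(* Let $f, g, h$ be probability mass functions on $\mathbf{Z}_+$ such that $f\leq_{\mathrm{lc}} g$ and $g\leq_{\mathrm{lc}} h$. If $f$ and $g$ have finite and equal means, then $D(f|h)<\infty$ and $$D(f|h)\geq D(f|g)+D(g|h).$$ If $h$ and $g$ have finite and equal means, then $$D(h|f)\geq D(h|g)+D(g|f).$$
   Context: $\mathbf{Z}_+=\{0,1,2,\ldots\}$. A probability mass function (pmf) on $\mathbf{Z}_+$ is a sequence $f=\{f_i, i\ge 0\}$ of non-negative reals with $\sum_i f_i=1$; its support is $\mathrm{supp}(f)=\{i: f_i>0\}$ and its mean is $\sum_i i f_i$. For two pmf's $f,g$ on $\mathbf{Z}_+$, write $f\leq_{\mathrm{lc}} g$ ($f$ is log-concave relative to $g$) if: (1) each of $f$ and $g$ is supported on an interval in $\mathbf{Z}_+$ (a set of consecutive integers, possibly infinite); (2) $\mathrm{supp}(f)\subset\mathrm{supp}(g)$; (3) $\log(f_i/g_i)$ is concave in $i\in\mathrm{supp}(f)$. The relative entropy is $D(f|g)=\sum_{i=0}^\infty f_i\log(f_i/g_i)$ if $\mathrm{supp}(f)\subset\mathrm{supp}(g)$, and $D(f|g)=\infty$ otherwise, with the convention $0\log(0/0)=0$ (and $0\log 0=0$); it takes values in $[0,\infty]$. *)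

theory Defs
  imports "HOL-Probability.Probability"
begin

definition interval_supported :: "nat pmf \<Rightarrow> bool" where
  "interval_supported f \<longleftrightarrow> (\<forall>i\<in>set_pmf f. \<forall>j\<in>set_pmf f. {i..j} \<subseteq> set_pmf f)"

(* The inequality of concave_on, required only at those convex combinations that lie in S;
   the library's concave_on needs a convex subset of a real vector space as domain. *)
definition discrete_concave_on :: "nat set \<Rightarrow> (nat \<Rightarrow> real) \<Rightarrow> bool" where
  "discrete_concave_on S u \<longleftrightarrow>
     (\<forall>i\<in>S. \<forall>j\<in>S. \<forall>k\<in>S. \<forall>t\<in>{0..1}.
        real k = (1 - t) * real i + t * real j \<longrightarrow> u k \<ge> (1 - t) * u i + t * u j)"

definition lc_le :: "nat pmf \<Rightarrow> nat pmf \<Rightarrow> bool" (infix "\<le>\<^sub>l\<^sub>c" 50) where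
  "f \<le>\<^sub>l\<^sub>c g \<longleftrightarrow>
     interval_supported f \<and> interval_supported g \<and>
     set_pmf f \<subseteq> set_pmf g \<and>
     discrete_concave_on (set_pmf f) (\<lambda>i. ln (pmf f i / pmf g i))"

(* The library constant KL_divergence is real-valued and is 0 where the integral diverges, so it
   cannot represent the value infinity. The terms of the series below may have both signs;
   relative_entropy_sums shows that it always converges in ereal. The conventions
   0 log 0 = 0 log (0/0) = 0 hold because the factor pmf f i is then 0. *)
definition relative_entropy :: "nat pmf \<Rightarrow> nat pmf \<Rightarrow> ereal" where
  "relative_entropy f g =
     (if set_pmf f \<subseteq> set_pmf g then (\<Sum>i. ereal (pmf f i * ln (pmf f i / pmf g i))) else \<infinity>)"

lemma pmf_sums_1: "pmf f sums 1" for f :: "nat pmf"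
proof -
  have "(pmf f has_sum 1) UNIV"
    using infsetsum_pmf_eq_1[of f UNIV] pmf_abs_summable[of f UNIV]
    by (metis abs_summable_equivalent abs_summable_summable has_sum_infsum infsetsum_infsum top_greatest)
  then show ?thesis
    by (rule has_sum_imp_sums)
qed

lemma relative_entropy_sums_nonneg:
  assumes "set_pmf f \<subseteq> set_pmf g"
  shows "(\<lambda>i. ereal (pmf f i * ln (pmf f i / pmf g i))) sums relative_entropy f g
         \<and> 0 \<le> relative_entropy f g"
proof -
  define a where "a = (\<lambda>i. pmf f i * ln (pmf f i / pmf g i))"
  define b where "b = (\<lambda>i. a i - (pmf f i - pmf g i))"
  have b: "0 \<le> b i" for i
  proof (cases "pmf f i = 0")
    case False
    then have f: "pmf f i > 0" by (simp add: pmf_pos)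
    with assms have g: "pmf g i > 0" by (meson pmf_positive_iff subsetD)
    have "ln (pmf g i / pmf f i) \<le> pmf g i / pmf f i - 1"
      using f g by (intro ln_le_minus_one) simp
    then have "pmf f i * ln (pmf g i / pmf f i) \<le> pmf f i * (pmf g i / pmf f i - 1)"
      using f by simp
    also have "\<dots> = pmf g i - pmf f i" using f by (simp add: field_simps)
    finally show ?thesis using f g by (simp add: a_def b_def ln_div algebra_simps)
  qed (simp add: a_def b_def)
  have d: "(\<lambda>n. \<Sum>i<n. pmf f i - pmf g i) \<longlonglongrightarrow> 0"
    using sums_diff[OF pmf_sums_1[of f] pmf_sums_1[of g]] by (simp add: sums_def)
  have "(\<lambda>i. ereal (b i)) sums (\<Sum>i. ereal (b i))"
    using b by (intro summable_sums summable_ereal_pos) simp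
  then have "(\<lambda>n. ereal (\<Sum>i<n. b i)) \<longlonglongrightarrow> (\<Sum>i. ereal (b i))"
    by (simp add: sums_def)
  moreover have "(\<lambda>n. ereal (\<Sum>i<n. pmf f i - pmf g i)) \<longlonglongrightarrow> 0"
    using d by (simp add: zero_ereal_def)
  ultimately have "(\<lambda>n. ereal (\<Sum>i<n. b i) + ereal (\<Sum>i<n. pmf f i - pmf g i))
      \<longlonglongrightarrow> (\<Sum>i. ereal (b i)) + 0"
    by (intro tendsto_add_ereal_general) auto
  then have "(\<lambda>i. ereal (a i)) sums (\<Sum>i. ereal (b i))"
    by (simp add: sums_def b_def sum_subtractf)
  moreover have "0 \<le> (\<Sum>i. ereal (b i))"
    using b by (intro suminf_0_le summable_ereal_pos) simp_all
  ultimately show ?thesis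
    using assms by (simp add: relative_entropy_def a_def sums_iff)
qed

lemma relative_entropy_sums:
  "set_pmf f \<subseteq> set_pmf g \<Longrightarrow>
     (\<lambda>i. ereal (pmf f i * ln (pmf f i / pmf g i))) sums relative_entropy f g"
  using relative_entropy_sums_nonneg by blast

lemma relative_entropy_nonneg: "0 \<le> relative_entropy f g"
  using relative_entropy_sums_nonneg[of f g]
  by (cases "set_pmf f \<subseteq> set_pmf g") (auto simp: relative_entropy_def)

end

theory Submission
  imports Defs
begin

text \<open>
  Expanding the logarithm of a quotient, the first inequality says that
  \<open>u = ln (g / h)\<close>, which is concave on the support of \<open>g\<close>, has at least as large a mean under
  \<open>f\<close> as under \<open>g\<close>; the second one says the same of \<open>ln (f / g)\<close> under \<open>g\<close> and \<open>h\<close>. Both are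
  instances of one comparison: \<open>f \<le>\<^sub>l\<^sub>c g\<close> and equality of the means put \<open>f\<close> below \<open>g\<close> in the
  convex order.

  The reason is a sign pattern. Since \<open>f / g\<close> is log-concave, the set where \<open>f > g\<close> is an interval,
  and equality of the means forbids it to be unbounded. Take the chord of a concave \<open>u\<close> over this
  interval (a supporting line if it is a single point). Then \<open>u\<close> is above that line where \<open>f > g\<close>
  and below it where \<open>f < g\<close>, so the product of \<open>f - g\<close> with the difference of \<open>u\<close> and the line is
  pointwise non-negative, while the line itself contributes nothing to the total because \<open>f\<close> and
  \<open>g\<close> have the same mass and mean (\<open>lc_le_affine_separation\<close>).

  Neither series in such a comparison need converge a priori, so it is formulated for partial sums
  with a vanishing error (\<open>lc_le_partial_sums_le\<close>). Finiteness of the entropies to be subtracted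
  comes from the fact that a concave function on an interval of integers has an affine upper bound
  (\<open>ln_ratio_affine_bound\<close>), and affine functions have a finite mean.
\<close>

section \<open>Concave functions on an interval of integers\<close>

lemma discrete_concave_on_three_points:
  assumes "discrete_concave_on S u" "i \<in> S" "j \<in> S" "k \<in> S" "i \<le> k" "k \<le> j"
  shows "(real j - real k) * u i + (real k - real i) * u j \<le> (real j - real i) * u k"
proof (cases "i = j")
  case True
  with assms show ?thesis by simp
next
  case False
  with assms have ij: "real i < real j" by simp
  define t where "t = (real k - real i) / (real j - real i)"
  have t: "t * (real j - real i) = real k - real i" using ij by (simp add: t_def)
  have "t \<in> {0..1}" using assms ij by (simp add: t_def divide_simps)
  moreover have "real k = (1 - t) * real i + t * real j" using t by (simp add: algebra_simps)
  ultimately have "(1 - t) * u i + t * u j \<le> u k"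
    using assms unfolding discrete_concave_on_def by blast
  then have "(real j - real i) * ((1 - t) * u i + t * u j) \<le> (real j - real i) * u k"
    using ij by (intro mult_left_mono) auto
  moreover have "(real j - real i) * ((1 - t) * u i + t * u j)
      = ((real j - real i) - t * (real j - real i)) * u i + t * (real j - real i) * u j"
    by (simp add: algebra_simps)
  ultimately show ?thesis unfolding t by simp
qed

lemma discrete_concave_on_chord:
  assumes u: "discrete_concave_on S u" and ab: "a \<in> S" "b \<in> S" "a < b"
  obtains c where "\<And>k. k \<in> S \<Longrightarrow> a \<le> k \<Longrightarrow> k \<le> b \<Longrightarrow> u a + c * (real k - real a) \<le> u k"
    and "\<And>k. k \<in> S \<Longrightarrow> k \<le> a \<or> b \<le> k \<Longrightarrow> u k \<le> u a + c * (real k - real a)"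
proof -
  define d where "d = real b - real a"
  define c where "c = (u b - u a) / d"
  have d: "0 < d" using ab by (simp add: d_def)
  have ub: "u b = u a + c * d" using d by (simp add: c_def)
  have rb: "real b = real a + d" by (simp add: d_def)
  show thesis
  proof
    fix k assume k: "k \<in> S" "a \<le> k" "k \<le> b"
    have "d * (u a + c * (real k - real a)) \<le> d * u k"
      using discrete_concave_on_three_points[OF u ab(1,2) k] unfolding ub rb
      by (simp add: algebra_simps)
    with d show "u a + c * (real k - real a) \<le> u k" by simp
  next
    fix k assume k: "k \<in> S" "k \<le> a \<or> b \<le> k"
    have "d * u k \<le> d * (u a + c * (real k - real a))"
      using k(2)
    proof
      assume "k \<le> a"
      with ab show ?thesis
        using discrete_concave_on_three_points[OF u k(1) ab(2,1)] unfolding ub rb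
        by (simp add: algebra_simps)
    next
      assume "b \<le> k"
      with ab show ?thesis
        using discrete_concave_on_three_points[OF u ab(1) k(1) ab(2)] unfolding ub rb
        by (simp add: algebra_simps)
    qed
    with d show "u k \<le> u a + c * (real k - real a)" by simp
  qed
qed

text \<open>
  No integer lies strictly between two neighbours, so the chord over two neighbouring points is
  also a supporting line at each of them.
\<close>

lemma discrete_concave_on_supporting_line:
  assumes u: "discrete_concave_on S u" and S: "\<And>i j. i \<in> S \<Longrightarrow> j \<in> S \<Longrightarrow> {i..j} \<subseteq> S"
    and a: "a \<in> S"
  obtains c where "\<And>k. k \<in> S \<Longrightarrow> u k \<le> u a + c * (real k - real a)"
proof -
  consider "Suc a \<in> S" | b where "a = Suc b" "b \<in> S" | "S = {a}"
  proof -
    have "\<exists>b. a = Suc b \<and> b \<in> S" if "k \<in> S" "k < a" for k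
      using S[OF that(1) a] that(2) by (cases a) auto
    moreover have "Suc a \<in> S" if "k \<in> S" "a < k" for k
      using S[OF a that(1)] that(2) by auto
    ultimately show thesis using that a
      by (metis linorder_neqE_nat is_singletonI' is_singleton_def singletonD empty_iff)
  qed
  then show thesis
  proof cases
    case 1
    obtain c where "\<And>k. k \<in> S \<Longrightarrow> k \<le> a \<or> Suc a \<le> k \<Longrightarrow> u k \<le> u a + c * (real k - real a)"
      using discrete_concave_on_chord[OF u a 1 lessI] by metis
    then show thesis using that by (metis not_less_eq_eq)
  next
    case 2
    obtain c where c: "\<And>k. k \<in> S \<Longrightarrow> k \<le> b \<or> a \<le> k \<Longrightarrow> u k \<le> u b + c * (real k - real b)"
      and c': "\<And>k. k \<in> S \<Longrightarrow> b \<le> k \<Longrightarrow> k \<le> a \<Longrightarrow> u b + c * (real k - real b) \<le> u k"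
      using discrete_concave_on_chord[OF u 2(2) a] 2 by (metis lessI)
    show thesis
    proof
      fix k assume k: "k \<in> S"
      have "u b + c \<le> u a" using c'[OF a] 2(1) by simp
      moreover have "u k \<le> u b + c * (real k - real b)"
        using c[OF k] 2(1) by (metis not_less_eq_eq)
      ultimately show "u k \<le> u a + c * (real k - real a)"
        using 2(1) by (simp add: algebra_simps)
    qed
  next
    case 3
    then show thesis using that[of 0] by simp
  qed
qed

section \<open>Moments as series\<close>

lemma pmf_mean_sums:
  fixes f :: "nat pmf"
  assumes "integrable (measure_pmf f) real"
  shows "(\<lambda>i. pmf f i * real i) sums measure_pmf.expectation f real"
proof -
  have "integrable (count_space UNIV) (\<lambda>i. pmf f i *\<^sub>R real i)"
    using assms by (simp add: measure_pmf_eq_density integrable_density)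
  from sums_integral_count_space_nat[OF this]
  show ?thesis by (simp add: measure_pmf_eq_density integral_density)
qed

lemma pmf_affine_sums:
  fixes f :: "nat pmf"
  assumes "integrable (measure_pmf f) real"
  shows "(\<lambda>i. pmf f i * (p + q * real i)) sums (p + q * measure_pmf.expectation f real)"
  using sums_add[OF sums_mult[OF pmf_sums_1[of f], of p] sums_mult[OF pmf_mean_sums[OF assms], of q]]
  by (simp add: algebra_simps)

lemma pmf_diff_affine_sums:
  fixes f g :: "nat pmf"
  assumes "integrable (measure_pmf f) real" "integrable (measure_pmf g) real"
    and "measure_pmf.expectation f real = measure_pmf.expectation g real"
  shows "(\<lambda>i. (pmf f i - pmf g i) * (p + q * real i)) sums 0"
  using sums_diff[OF pmf_affine_sums[OF assms(1), of p q] pmf_affine_sums[OF assms(2), of p q]] assms(3)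
  by (simp add: left_diff_distrib)

lemma pmf_eqI_le:
  fixes f g :: "nat pmf"
  assumes le: "\<And>i. pmf f i \<le> pmf g i"
  shows "pmf f i = pmf g i"
proof -
  have "(\<lambda>i. pmf g i - pmf f i) sums 0"
    using sums_diff[OF pmf_sums_1[of g] pmf_sums_1[of f]] by simp
  then have "\<forall>i. pmf g i - pmf f i = 0"
    using le suminf_eq_zero_iff[of "\<lambda>i. pmf g i - pmf f i"] by (simp add: sums_iff)
  then show ?thesis by simp
qed

section \<open>Relative log-concavity implies convex order\<close>

lemma lc_leD:
  assumes "f \<le>\<^sub>l\<^sub>c g"
  shows "set_pmf f \<subseteq> set_pmf g"
    and "discrete_concave_on (set_pmf f) (\<lambda>i. ln (pmf f i / pmf g i))"
    and "\<And>i j. i \<in> set_pmf f \<Longrightarrow> j \<in> set_pmf f \<Longrightarrow> {i..j} \<subseteq> set_pmf f"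
    and "\<And>i j. i \<in> set_pmf g \<Longrightarrow> j \<in> set_pmf g \<Longrightarrow> {i..j} \<subseteq> set_pmf g"
  using assms unfolding lc_le_def interval_supported_def by blast+

text \<open>
  A concave function that is positive at two points is positive between them; here it is
  the logarithm of the ratio.
\<close>

lemma lc_le_excess_interval:
  assumes lc: "f \<le>\<^sub>l\<^sub>c g"
    and i: "pmf g i < pmf f i" and j: "pmf g j < pmf f j" and k: "i \<le> k" "k \<le> j"
  shows "pmf g k < pmf f k"
proof -
  define u where "u = (\<lambda>i. ln (pmf f i / pmf g i))"
  have mem: "m \<in> set_pmf f \<and> 0 < u m" if "pmf g m < pmf f m" for m
  proof -
    have "0 < pmf f m" using that pmf_nonneg[of g m] by linarith
    then have m: "m \<in> set_pmf f" by (simp add: pmf_positive_iff)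
    with lc_leD(1)[OF lc] have "0 < pmf g m" by (auto simp: pmf_positive_iff)
    with that m show ?thesis by (simp add: u_def)
  qed
  from mem[OF i] mem[OF j] have ij: "i \<in> set_pmf f" "0 < u i" "j \<in> set_pmf f" "0 < u j" by auto
  with lc_leD(3)[OF lc, of i j] k have kf: "k \<in> set_pmf f" by auto
  show ?thesis
  proof (cases "k = i \<or> k = j")
    case True
    with i j show ?thesis by auto
  next
    case False
    with k have lt: "real i < real k" "real k < real j" by auto
    have "0 < (real j - real k) * u i + (real k - real i) * u j"
      using lt ij by (intro add_pos_pos mult_pos_pos) auto
    also have "\<dots> \<le> (real j - real i) * u k"
      using discrete_concave_on_three_points[OF lc_leD(2)[OF lc] ij(1,3) kf k] by (simp add: u_def)
    finally have "0 < u k" using lt by (simp add: zero_less_mult_iff)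
    moreover have "0 < pmf f k" "0 < pmf g k" using kf lc_leD(1)[OF lc] by (auto simp: pmf_positive_iff)
    ultimately show ?thesis by (simp add: u_def ln_div)
  qed
qed

text \<open>
  If the interval where \<open>f\<close> exceeds \<open>g\<close> had a left endpoint \<open>a\<close> but no right one, all terms
  of \<open>\<Sum>i. (f i - g i) * (i - a)\<close> would be non-negative and some positive, although equality of
  mass and mean makes this sum vanish.
\<close>

lemma lc_le_excess_bounds:
  assumes lc: "f \<le>\<^sub>l\<^sub>c g"
    and mean: "integrable (measure_pmf f) real" "integrable (measure_pmf g) real"
      "measure_pmf.expectation f real = measure_pmf.expectation g real"
    and i: "pmf g i < pmf f i"
  obtains a b where "a \<le> b" "\<And>k. pmf g k < pmf f k \<longleftrightarrow> a \<le> k \<and> k \<le> b"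
proof -
  define P where "P = {k. pmf g k < pmf f k}"
  define a where "a = (LEAST k. k \<in> P)"
  have aP: "a \<in> P" and amin: "k \<in> P \<Longrightarrow> a \<le> k" for k
    unfolding a_def using i by (auto simp: P_def intro: LeastI Least_le)
  have conv: "m \<in> P \<Longrightarrow> a \<le> k \<Longrightarrow> k \<le> m \<Longrightarrow> k \<in> P" for k m
    using lc_le_excess_interval[OF lc, of a m k] aP by (simp add: P_def)
  have "finite P"
  proof (rule ccontr)
    assume "infinite P"
    then have inP: "k \<in> P" if "a \<le> k" for k
      using conv that by (metis infinite_nat_iff_unbounded_le)
    define t where "t = (\<lambda>k. (pmf f k - pmf g k) * (- real a + 1 * real k))"
    have "0 \<le> t k" for k
    proof (cases "a \<le> k")
      case True
      then show ?thesis using inP[OF True] by (simp add: t_def P_def)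
    next
      case False
      then have "k \<notin> P" using amin by auto
      with False show ?thesis by (auto simp: t_def P_def intro: mult_nonpos_nonpos)
    qed
    moreover have "t sums 0"
      unfolding t_def by (rule pmf_diff_affine_sums[OF mean])
    ultimately have "t (Suc a) = 0"
      using suminf_eq_zero_iff[of t] by (simp add: sums_iff)
    moreover have "Suc a \<in> P" by (simp add: inP)
    ultimately show False by (simp add: t_def P_def)
  qed
  with aP have M: "Max P \<in> P" "\<And>k. k \<in> P \<Longrightarrow> k \<le> Max P"
    using Max_in Max_ge by blast+
  show thesis
  proof (rule that[of a "Max P"])
    show "a \<le> Max P" using aP M by auto
    show "pmf g k < pmf f k \<longleftrightarrow> a \<le> k \<and> k \<le> Max P" for k
      using conv[OF M(1)] amin[of k] M(2)[of k] by (auto simp: P_def)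
  qed
qed

text \<open>
  The separating line is the chord of \<open>u\<close> over the interval where \<open>f\<close> exceeds \<open>g\<close>. If that
  interval is a single point, the chord degenerates and is replaced by a supporting line.
\<close>

lemma lc_le_affine_separation:
  assumes lc: "f \<le>\<^sub>l\<^sub>c g"
    and mean: "integrable (measure_pmf f) real" "integrable (measure_pmf g) real"
      "measure_pmf.expectation f real = measure_pmf.expectation g real"
    and u: "discrete_concave_on (set_pmf g) u"
  obtains p q where "\<And>i. 0 \<le> (pmf f i - pmf g i) * (u i - (p + q * real i))"
proof (cases "\<exists>i. pmf g i < pmf f i")
  case False
  then have "pmf f i = pmf g i" for i
    using pmf_eqI_le[of f g] by (simp add: not_less)
  then show thesis using that by simp
next
  case True
  then obtain i where i: "pmf g i < pmf f i" ..
  obtain a b where ab: "a \<le> b" and P: "\<And>k. pmf g k < pmf f k \<longleftrightarrow> a \<le> k \<and> k \<le> b"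
    using lc_le_excess_bounds[OF lc mean i] by blast
  have mem: "k \<in> set_pmf g" if "a \<le> k" "k \<le> b" for k
  proof -
    have "pmf g k < pmf f k" using P that by simp
    then have "0 < pmf f k" using pmf_nonneg[of g k] by linarith
    then show ?thesis using lc_leD(1)[OF lc] by (auto simp: pmf_positive_iff)
  qed
  obtain c where
      inside: "\<And>k. k \<in> set_pmf g \<Longrightarrow> a \<le> k \<Longrightarrow> k \<le> b \<Longrightarrow> u a + c * (real k - real a) \<le> u k"
    and outside: "\<And>k. k \<in> set_pmf g \<Longrightarrow> k \<le> a \<or> b \<le> k \<Longrightarrow> u k \<le> u a + c * (real k - real a)"
  proof (cases "a = b")
    case True
    obtain c where "\<And>k. k \<in> set_pmf g \<Longrightarrow> u k \<le> u a + c * (real k - real a)"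
      using discrete_concave_on_supporting_line[OF u lc_leD(4)[OF lc] mem] True by blast
    then show thesis using that[of c] True by auto
  next
    case False
    with ab have "a < b" by simp
    from discrete_concave_on_chord[OF u mem mem this] show thesis using ab that by blast
  qed
  show thesis
  proof (rule that[of "u a - c * real a" c])
    fix k
    have eq: "u a - c * real a + c * real k = u a + c * (real k - real a)"
      by (simp add: algebra_simps)
    show "0 \<le> (pmf f k - pmf g k) * (u k - (u a - c * real a + c * real k))"
    proof (cases "a \<le> k \<and> k \<le> b")
      case True
      then show ?thesis unfolding eq
        using P[of k] inside[OF mem] by (intro mult_nonneg_nonneg) auto
    next
      case out: False
      then have le: "pmf f k \<le> pmf g k" using P[of k] by auto
      show ?thesis
      proof (cases "k \<in> set_pmf g")
        case True
        then show ?thesis unfolding eq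
          using le out outside[OF True] by (intro mult_nonpos_nonpos) auto
      next
        case False
        then have "pmf g k = 0" by (simp add: set_pmf_iff)
        with le pmf_nonneg[of f k] show ?thesis by simp
      qed
    qed
  qed
qed

text \<open>
  The error \<open>e\<close> is the contribution of the separating line, which vanishes only in the limit.
\<close>

lemma lc_le_partial_sums_le:
  assumes "f \<le>\<^sub>l\<^sub>c g"
    and mean: "integrable (measure_pmf f) real" "integrable (measure_pmf g) real"
      "measure_pmf.expectation f real = measure_pmf.expectation g real"
    and "discrete_concave_on (set_pmf g) u"
  obtains e where "e \<longlonglongrightarrow> 0"
    and "\<And>n. (\<Sum>i<n. pmf g i * u i) \<le> (\<Sum>i<n. pmf f i * u i) + e n"
proof -
  obtain p q where pq: "\<And>i. 0 \<le> (pmf f i - pmf g i) * (u i - (p + q * real i))"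
    using lc_le_affine_separation[OF assms] by blast
  define l where "l = (\<lambda>i. (pmf f i - pmf g i) * (p + q * real i))"
  have "(\<lambda>n. \<Sum>i<n. l i) \<longlonglongrightarrow> 0"
    using pmf_diff_affine_sums[OF mean, of p q] by (simp add: sums_def l_def)
  then have "(\<lambda>n. - (\<Sum>i<n. l i)) \<longlonglongrightarrow> 0"
    using tendsto_minus by fastforce
  moreover have "(\<Sum>i<n. pmf g i * u i) \<le> (\<Sum>i<n. pmf f i * u i) + - (\<Sum>i<n. l i)" for n
  proof -
    have "(\<Sum>i<n. pmf g i * u i) \<le> (\<Sum>i<n. pmf f i * u i - l i)"
    proof (rule sum_mono)
      fix i
      show "pmf g i * u i \<le> pmf f i * u i - l i"
        using pq[of i] by (simp add: l_def algebra_simps)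
    qed
    then show ?thesis by (simp add: sum_subtractf)
  qed
  ultimately show thesis using that by blast
qed

section \<open>Finiteness of relative entropies\<close>

lemma relative_entropy_real_sums:
  assumes "set_pmf f \<subseteq> set_pmf g" "relative_entropy f g < \<infinity>"
  obtains d where "relative_entropy f g = ereal d"
    and "(\<lambda>i. pmf f i * ln (pmf f i / pmf g i)) sums d"
proof -
  obtain d where d: "relative_entropy f g = ereal d"
    using assms(2) relative_entropy_nonneg[of f g] by (cases "relative_entropy f g") auto
  with relative_entropy_sums[OF assms(1)] show thesis using that by (simp add: sums_def)
qed

lemma relative_entropy_finiteI:
  assumes "set_pmf f \<subseteq> set_pmf g"
    and le: "\<And>i. pmf f i * ln (pmf f i / pmf g i) \<le> b i" and b: "summable b"
  shows "relative_entropy f g < \<infinity>"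
proof -
  have "(\<lambda>n. ereal (\<Sum>i<n. pmf f i * ln (pmf f i / pmf g i))) \<longlonglongrightarrow> relative_entropy f g"
    using relative_entropy_sums[OF assms(1)] by (simp add: sums_def)
  moreover have "(\<lambda>n. ereal (\<Sum>i<n. b i)) \<longlonglongrightarrow> ereal (suminf b)"
    using summable_LIMSEQ[OF b] by simp
  ultimately have "relative_entropy f g \<le> ereal (suminf b)"
    by (rule LIMSEQ_le) (auto intro!: sum_mono le)
  then show ?thesis by auto
qed

lemma ln_ratio_affine_bound:
  assumes lc: "f \<le>\<^sub>l\<^sub>c g"
  obtains p q where "\<And>i. i \<in> set_pmf f \<Longrightarrow> ln (pmf f i / pmf g i) \<le> p + q * real i"
proof -
  define u where "u = (\<lambda>i. ln (pmf f i / pmf g i))"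
  obtain a where a: "a \<in> set_pmf f" using set_pmf_not_empty[of f] by blast
  obtain c where "\<And>k. k \<in> set_pmf f \<Longrightarrow> u k \<le> u a + c * (real k - real a)"
    using discrete_concave_on_supporting_line[OF lc_leD(2,3)[OF lc] a] by (auto simp: u_def)
  then show thesis
    using that[of "u a - c * real a" c] by (simp add: u_def algebra_simps)
qed

lemma pmf_times_ln_chain:
  assumes "i \<in> set_pmf w \<Longrightarrow> i \<in> set_pmf f \<inter> set_pmf g \<inter> set_pmf h"
  shows "pmf w i * ln (pmf f i / pmf h i)
      = pmf w i * ln (pmf f i / pmf g i) + pmf w i * ln (pmf g i / pmf h i)"
proof (cases "i \<in> set_pmf w")
  case True
  with assms have "0 < pmf f i" "0 < pmf g i" "0 < pmf h i" by (auto simp: pmf_positive_iff)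
  then show ?thesis by (simp add: ln_div algebra_simps)
qed (simp add: set_pmf_iff)

lemma lc_le_relative_entropy_finite:
  assumes lc: "f \<le>\<^sub>l\<^sub>c g" and mean: "integrable (measure_pmf f) real"
  shows "relative_entropy f g < \<infinity>"
proof -
  obtain p q where pq: "\<And>i. i \<in> set_pmf f \<Longrightarrow> ln (pmf f i / pmf g i) \<le> p + q * real i"
    using ln_ratio_affine_bound[OF lc] by blast
  have "pmf f i * ln (pmf f i / pmf g i) \<le> pmf f i * (p + q * real i)" for i
    using pq[of i] by (cases "i \<in> set_pmf f") (auto simp: set_pmf_iff intro: mult_left_mono)
  then show ?thesis
    by (rule relative_entropy_finiteI[OF lc_leD(1)[OF lc] _ sums_summable[OF pmf_affine_sums[OF mean]]])
qed

lemma lc_le_chain_relative_entropy_finite: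
  assumes fg: "f \<le>\<^sub>l\<^sub>c g" and gh: "g \<le>\<^sub>l\<^sub>c h" and mean: "integrable (measure_pmf f) real"
  shows "relative_entropy f h < \<infinity>"
proof -
  note sub = lc_leD(1)[OF fg] lc_leD(1)[OF gh]
  obtain p q where pq: "\<And>i. i \<in> set_pmf g \<Longrightarrow> ln (pmf g i / pmf h i) \<le> p + q * real i"
    using ln_ratio_affine_bound[OF gh] by blast
  obtain d where d: "(\<lambda>i. pmf f i * ln (pmf f i / pmf g i)) sums d"
    using relative_entropy_real_sums[OF sub(1) lc_le_relative_entropy_finite[OF fg mean]] .
  have "pmf f i * ln (pmf f i / pmf h i)
      \<le> pmf f i * ln (pmf f i / pmf g i) + pmf f i * (p + q * real i)" for i
  proof -
    have "pmf f i * ln (pmf g i / pmf h i) \<le> pmf f i * (p + q * real i)"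
      using pq[of i] sub by (cases "i \<in> set_pmf f") (auto simp: set_pmf_iff intro: mult_left_mono)
    moreover have "pmf f i * ln (pmf f i / pmf h i)
        = pmf f i * ln (pmf f i / pmf g i) + pmf f i * ln (pmf g i / pmf h i)"
      using sub by (intro pmf_times_ln_chain) blast
    ultimately show ?thesis by simp
  qed
  moreover have "summable (\<lambda>i. pmf f i * ln (pmf f i / pmf g i) + pmf f i * (p + q * real i))"
    using sums_add[OF d pmf_affine_sums[OF mean]] by (rule sums_summable)
  ultimately show ?thesis
    by (rule relative_entropy_finiteI[OF subset_trans[OF sub]])
qed

section \<open>Superadditivity of relative entropy\<close>

lemma relative_entropy_superadditive_forward:
  assumes fg: "f \<le>\<^sub>l\<^sub>c g" and gh: "g \<le>\<^sub>l\<^sub>c h"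
    and mean: "integrable (measure_pmf f) real" "integrable (measure_pmf g) real"
      "measure_pmf.expectation f real = measure_pmf.expectation g real"
  shows "relative_entropy f g + relative_entropy g h \<le> relative_entropy f h"
proof -
  note sub = lc_leD(1)[OF fg] lc_leD(1)[OF gh]
  obtain d_fg where fg_sums: "relative_entropy f g = ereal d_fg"
      "(\<lambda>i. pmf f i * ln (pmf f i / pmf g i)) sums d_fg"
    using relative_entropy_real_sums[OF sub(1) lc_le_relative_entropy_finite[OF fg mean(1)]] .
  obtain d_gh where gh_sums: "relative_entropy g h = ereal d_gh"
      "(\<lambda>i. pmf g i * ln (pmf g i / pmf h i)) sums d_gh"
    using relative_entropy_real_sums[OF sub(2) lc_le_relative_entropy_finite[OF gh mean(2)]] .
  obtain d_fh where fh_sums: "relative_entropy f h = ereal d_fh"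
      "(\<lambda>i. pmf f i * ln (pmf f i / pmf h i)) sums d_fh"
    using relative_entropy_real_sums[OF _ lc_le_chain_relative_entropy_finite[OF fg gh mean(1)]] sub
    by blast
  define u where "u = (\<lambda>i. ln (pmf g i / pmf h i))"
  have "pmf f i * u i = pmf f i * ln (pmf f i / pmf h i) - pmf f i * ln (pmf f i / pmf g i)" for i
  proof -
    have "i \<in> set_pmf f \<Longrightarrow> i \<in> set_pmf f \<inter> set_pmf g \<inter> set_pmf h" using sub by blast
    from pmf_times_ln_chain[OF this] show ?thesis by (simp add: u_def)
  qed
  with sums_diff[OF fh_sums(2) fg_sums(2)]
  have fu: "(\<lambda>i. pmf f i * u i) sums (d_fh - d_fg)" by simp
  have "discrete_concave_on (set_pmf g) u"
    using lc_leD(2)[OF gh] by (simp add: u_def)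
  from lc_le_partial_sums_le[OF fg mean this] obtain e where e: "e \<longlonglongrightarrow> 0"
    and le: "\<And>n. (\<Sum>i<n. pmf g i * u i) \<le> (\<Sum>i<n. pmf f i * u i) + e n" by blast
  have "(\<lambda>n. \<Sum>i<n. pmf g i * u i) \<longlonglongrightarrow> d_gh"
    using gh_sums(2) by (simp add: sums_def u_def)
  moreover have "(\<lambda>n. (\<Sum>i<n. pmf f i * u i) + e n) \<longlonglongrightarrow> d_fh - d_fg"
    using tendsto_add[OF fu[unfolded sums_def] e] by simp
  ultimately have "d_gh \<le> d_fh - d_fg"
    using le by (intro LIMSEQ_le) auto
  then show ?thesis by (simp add: fg_sums(1) gh_sums(1) fh_sums(1))
qed

text \<open>
  A finite \<open>D(h|f)\<close> forces all three supports to coincide, and it controls \<open>D(h|g)\<close> because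
  \<open>ln (h / g) = ln (h / f) + ln (f / g)\<close> with the last term bounded above by an affine function.
  Finiteness of \<open>D(g|f)\<close> is then a consequence of the comparison of partial sums.
\<close>

lemma relative_entropy_superadditive_backward:
  assumes fg: "f \<le>\<^sub>l\<^sub>c g" and gh: "g \<le>\<^sub>l\<^sub>c h"
    and mean: "integrable (measure_pmf h) real" "integrable (measure_pmf g) real"
      "measure_pmf.expectation h real = measure_pmf.expectation g real"
  shows "relative_entropy h g + relative_entropy g f \<le> relative_entropy h f"
proof (cases "relative_entropy h f = \<infinity>")
  case True
  then show ?thesis by simp
next
  case False
  then have "set_pmf h \<subseteq> set_pmf f" by (metis relative_entropy_def)
  with lc_leD(1)[OF fg] lc_leD(1)[OF gh]
  have supp: "set_pmf f = set_pmf h" "set_pmf g = set_pmf h" by auto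
  obtain d_hf where hf_sums: "relative_entropy h f = ereal d_hf"
      "(\<lambda>i. pmf h i * ln (pmf h i / pmf f i)) sums d_hf"
    using relative_entropy_real_sums[of h f] False supp by auto
  obtain p q where pq: "\<And>i. i \<in> set_pmf f \<Longrightarrow> ln (pmf f i / pmf g i) \<le> p + q * real i"
    using ln_ratio_affine_bound[OF fg] by blast
  define u where "u = (\<lambda>i. ln (pmf f i / pmf g i))"
  have chain: "pmf h i * ln (pmf h i / pmf g i) = pmf h i * ln (pmf h i / pmf f i) + pmf h i * u i" for i
    unfolding u_def by (intro pmf_times_ln_chain) (simp add: supp)
  have "relative_entropy h g < \<infinity>"
  proof (rule relative_entropy_finiteI)
    show "set_pmf h \<subseteq> set_pmf g" by (simp add: supp)
    show "pmf h i * ln (pmf h i / pmf g i)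
        \<le> pmf h i * ln (pmf h i / pmf f i) + pmf h i * (p + q * real i)" for i
      unfolding chain using pq[of i] supp
      by (cases "i \<in> set_pmf h") (auto simp: u_def set_pmf_iff intro: mult_left_mono)
    show "summable (\<lambda>i. pmf h i * ln (pmf h i / pmf f i) + pmf h i * (p + q * real i))"
      using sums_add[OF hf_sums(2) pmf_affine_sums[OF mean(1)]] by (rule sums_summable)
  qed
  then obtain d_hg where hg_sums: "relative_entropy h g = ereal d_hg"
      "(\<lambda>i. pmf h i * ln (pmf h i / pmf g i)) sums d_hg"
    using relative_entropy_real_sums[of h g] supp by auto
  have hu: "(\<lambda>i. pmf h i * u i) sums (d_hg - d_hf)"
    using sums_diff[OF hg_sums(2) hf_sums(2)] by (simp add: chain)
  have "discrete_concave_on (set_pmf h) u"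
    using lc_leD(2)[OF fg] by (simp add: u_def supp)
  from lc_le_partial_sums_le[OF gh mean(2,1) mean(3)[symmetric] this] obtain e where e: "e \<longlonglongrightarrow> 0"
    and le: "\<And>n. (\<Sum>i<n. pmf h i * u i) \<le> (\<Sum>i<n. pmf g i * u i) + e n" by blast
  have gu: "pmf g i * ln (pmf g i / pmf f i) = - (pmf g i * u i)" for i
  proof (cases "i \<in> set_pmf g")
    case True
    then have "0 < pmf g i" "0 < pmf f i" using supp by (auto simp: pmf_positive_iff)
    then show ?thesis by (simp add: u_def ln_div algebra_simps)
  qed (simp add: set_pmf_iff)
  have "(\<lambda>n. ereal (\<Sum>i<n. pmf g i * ln (pmf g i / pmf f i))) \<longlonglongrightarrow> relative_entropy g f"
    using relative_entropy_sums[of g f] supp by (simp add: sums_def)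
  moreover have "(\<lambda>n. ereal (e n - (\<Sum>i<n. pmf h i * u i))) \<longlonglongrightarrow> ereal (d_hf - d_hg)"
    using tendsto_diff[OF e hu[unfolded sums_def]] by simp
  moreover have "\<exists>N. \<forall>n\<ge>N. ereal (\<Sum>i<n. pmf g i * ln (pmf g i / pmf f i))
      \<le> ereal (e n - (\<Sum>i<n. pmf h i * u i))"
    using le by (simp add: gu sum_negf algebra_simps)
  ultimately have "relative_entropy g f \<le> ereal (d_hf - d_hg)"
    by (rule LIMSEQ_le)
  then have "relative_entropy h g + relative_entropy g f \<le> ereal d_hg + ereal (d_hf - d_hg)"
    unfolding hg_sums(1) by (rule add_left_mono)
  then show ?thesis by (simp add: hf_sums(1))
qed

theorem theorem1:
  fixes f g h :: "nat pmf"
  assumes "f \<le>\<^sub>l\<^sub>c g" and "g \<le>\<^sub>l\<^sub>c h"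
  shows "(integrable (measure_pmf f) real \<and> integrable (measure_pmf g) real \<and>
            measure_pmf.expectation f real = measure_pmf.expectation g real \<longrightarrow>
            relative_entropy f h < \<infinity> \<and>
            relative_entropy f h \<ge> relative_entropy f g + relative_entropy g h) \<and>
         (integrable (measure_pmf h) real \<and> integrable (measure_pmf g) real \<and>
            measure_pmf.expectation h real = measure_pmf.expectation g real \<longrightarrow>
            relative_entropy h f \<ge> relative_entropy h g + relative_entropy g f)"
  using lc_le_chain_relative_entropy_finite[OF assms]
    relative_entropy_superadditive_forward[OF assms]
    relative_entropy_superadditive_backward[OF assms]
  by blast

end
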